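(* Let $\mathcal{G}=(V,(V_1,V_2,V_P),\delta)$ be a stochastic game and $T$ its set of terminal vertices. Then: (1) for every $v\in V$: $\Pr^{\pi_1,\pi_2}_{\mathcal{G},v}(\Diamond T)=1$ for every Player 1 strategy $\pi_1$ and every fair Player 2 strategy $\pi_2$ if and only if $v\in V\setminus \exists\mathrm{Pre}_f^*(V\setminus\forall\mathrm{Pre}_f^*(T))$; (2) $\mathcal{G}$ is stopping under fairness if and only if $\exists\mathrm{Pre}_f^*(V\setminus\forall\mathrm{Pre}_f^*(T))=\emptyset$.
   Context: A stochastic game is a tuple $\mathcal{G}=(V,(V_1,V_2,V_P),\delta)$ where $V$ is a finite set of vertices, $V_1,V_2,V_P$ form a partition of $V$, and $\delta:V\times V\to[0,1]$ satisfies $\delta(v,v')\in\{0,1\}$ for $v\in V_1\cup V_2$, $v'\in V$, and $\delta(v,\cdot)$ is a probability distribution on $V$ for $v\in V_P$. Let $\mathrm{post}(v)=\{v'\mid \delta(v,v')>0\}$; it is assumed $\mathrm{post}(v)\neq\emptyset$ for all $v$. A vertex $v$ is terminal if $\delta(v,v)=1$ and $\delta(v,v')=0$ for $v'\neq v$. A path is an infinite sequence $\omega=v_0v_1\dots$ with $\delta(v_k,v_{k+1})>0$ for all $k$; $\inf(\omega)$ is the set of vertices occurring infinitely often in $\omega$. A strategy for Player $i\in\{1,2\}$ is a function $\pi_i:V^*V_i\to\mathcal{D}(V)$ with $\pi_i(\hat\omega u)(u')>0$ only if $u'\in\mathrm{post}(u)$. Given strategies $\pi_1,\pi_2$ and initial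 vertex $v$, $\Pr^{\pi_1,\pi_2}_{\mathcal{G},v}$ is the induced probability measure on paths starting at $v$. $\Diamond T$ is the set of paths visiting $T$. Fair plays: $FP^2=\{\omega\mid \forall v'\in V_2:\ v'\in\inf(\omega)\Rightarrow \mathrm{post}(v')\subseteq\inf(\omega)\}$; a Player 2 strategy $\pi_2$ is fair if $\Pr^{\pi_1,\pi_2}_{\mathcal{G},u}(FP^2)=1$ for every Player 1 strategy $\pi_1$ and every $u\in V$. $\mathcal{G}$ is stopping under fairness if $\Pr^{\pi_1,\pi_2}_{\mathcal{G},v}(\Diamond T)=1$ for all $\pi_1$, all fair $\pi_2$, all $v$. For $C\subseteq V$ write $\delta(v,C)=\sum_{v'\in C}\delta(v,v')$ and define $\exists\mathrm{Pre}_f(C)=\{v\in V\mid\delta(v,C)>0\}$ and $\forall\mathrm{Pre}_f(C)=\{v\in V_2\cup V_P\mid \delta(v,C)>0\}\cup\{v\in V_1\mid \forall v'\in V:\delta(v,v')>0\Rightarrow v'\in C\}$. For an operator $P\in\{\exists\mathrm{Pre}_f,\forall\mathrm{Pre}_f\}$, $P^*(C)$ denotes its transitive closure, i.e. $P^*(C)=\bigcup_{n\ge0}C_n$ with $C_0=C$ and $C_{n+1}=C_n\cup P(C_n)$. *)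

theory Defs
  imports "HOL-Probability.Probability"
begin

record 'v game =
  verts :: "'v set"
  verts1 :: "'v set"
  verts2 :: "'v set"
  vertsP :: "'v set"
  delta :: "'v \<Rightarrow> 'v \<Rightarrow> real"

definition post :: "'v game \<Rightarrow> 'v \<Rightarrow> 'v set" where
  "post G v = {v' \<in> verts G. delta G v v' > 0}"

locale stochastic_game =
  fixes G :: "'v game"
  assumes finite_verts: "finite (verts G)"
    and verts_Un: "verts G = verts1 G \<union> verts2 G \<union> vertsP G"
    and verts_disjoint: "verts1 G \<inter> verts2 G = {}" "verts1 G \<inter> vertsP G = {}"
      "verts2 G \<inter> vertsP G = {}"
    and delta_range: "\<And>v v'. v \<in> verts G \<Longrightarrow> v' \<in> verts G \<Longrightarrow> delta G v v' \<in> {0..1}"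
    and delta_player: "\<And>v v'. v \<in> verts1 G \<union> verts2 G \<Longrightarrow> v' \<in> verts G \<Longrightarrow> delta G v v' \<in> {0, 1}"
    and delta_prob: "\<And>v. v \<in> vertsP G \<Longrightarrow> (\<Sum>v'\<in>verts G. delta G v v') = 1"
    and post_nonempty: "\<And>v. v \<in> verts G \<Longrightarrow> post G v \<noteq> {}"

definition terminal_verts :: "'v game \<Rightarrow> 'v set" where
  "terminal_verts G =
     {v \<in> verts G. delta G v v = 1 \<and> (\<forall>v'\<in>verts G. v' \<noteq> v \<longrightarrow> delta G v v' = 0)}"

definition paths :: "'v game \<Rightarrow> (nat \<Rightarrow> 'v) set" where
  "paths G = {\<omega>. (\<forall>k. \<omega> k \<in> verts G) \<and> (\<forall>k. delta G (\<omega> k) (\<omega> (Suc k)) > 0)}"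

definition inf_verts :: "(nat \<Rightarrow> 'v) \<Rightarrow> 'v set" where
  "inf_verts \<omega> = {v. \<exists>\<^sub>\<infinity>k. \<omega> k = v}"

definition eventually_visits :: "'v game \<Rightarrow> 'v set \<Rightarrow> (nat \<Rightarrow> 'v) set" where
  "eventually_visits G T = {\<omega> \<in> paths G. \<exists>k. \<omega> k \<in> T}"

definition fair_plays2 :: "'v game \<Rightarrow> (nat \<Rightarrow> 'v) set" where
  "fair_plays2 G =
     {\<omega> \<in> paths G. \<forall>v'\<in>verts2 G. v' \<in> inf_verts \<omega> \<longrightarrow> post G v' \<subseteq> inf_verts \<omega>}"

text \<open>
  A strategy maps a nonempty history, whose last vertex belongs to the player, to a
  distribution on its successors. Values on other lists are unconstrained; they do not enter
  the induced measure.
\<close>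

definition strategy :: "'v game \<Rightarrow> 'v set \<Rightarrow> ('v list \<Rightarrow> 'v pmf) \<Rightarrow> bool" where
  "strategy G W \<pi> \<longleftrightarrow>
     (\<forall>h u. set h \<subseteq> verts G \<longrightarrow> u \<in> W \<longrightarrow> set_pmf (\<pi> (h @ [u])) \<subseteq> post G u)"

abbreviation strategy1 :: "'v game \<Rightarrow> ('v list \<Rightarrow> 'v pmf) \<Rightarrow> bool" where
  "strategy1 G \<equiv> strategy G (verts1 G)"

abbreviation strategy2 :: "'v game \<Rightarrow> ('v list \<Rightarrow> 'v pmf) \<Rightarrow> bool" where
  "strategy2 G \<equiv> strategy G (verts2 G)"

text \<open>
  The history \<open>h\<close> includes the current vertex; by the partition property, the last case of
  \<open>step_prob\<close> is that of a probabilistic vertex. In \<open>init_step_prob\<close> the empty history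
  stands for the choice of the initial vertex \<open>v\<close>.
\<close>

definition step_prob ::
  "'v game \<Rightarrow> ('v list \<Rightarrow> 'v pmf) \<Rightarrow> ('v list \<Rightarrow> 'v pmf) \<Rightarrow> 'v list \<Rightarrow> 'v \<Rightarrow> real" where
  "step_prob G \<pi>1 \<pi>2 h u =
     (if last h \<in> verts1 G then pmf (\<pi>1 h) u
      else if last h \<in> verts2 G then pmf (\<pi>2 h) u
      else delta G (last h) u)"

definition init_step_prob ::
  "'v game \<Rightarrow> ('v list \<Rightarrow> 'v pmf) \<Rightarrow> ('v list \<Rightarrow> 'v pmf) \<Rightarrow> 'v \<Rightarrow> 'v list \<Rightarrow> 'v \<Rightarrow> real" where
  "init_step_prob G \<pi>1 \<pi>2 v h u =
     (if h = [] then (if u = v then 1 else 0) else step_prob G \<pi>1 \<pi>2 h u)"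

definition play_kernel ::
  "'v game \<Rightarrow> ('v list \<Rightarrow> 'v pmf) \<Rightarrow> ('v list \<Rightarrow> 'v pmf) \<Rightarrow> 'v \<Rightarrow> nat \<Rightarrow> (nat \<Rightarrow> 'v) \<Rightarrow> 'v measure"
  where
  "play_kernel G \<pi>1 \<pi>2 v n \<omega> =
     point_measure (verts G) (\<lambda>u. ennreal (init_step_prob G \<pi>1 \<pi>2 v (map \<omega> [0..<n]) u))"

text \<open>
  The induced measure is the Ionescu-Tulcea limit of these kernels. It lives on all
  vertex sequences with the product (cylinder) sigma-algebra; the lemmas below show that it
  has the expected cylinder probabilities and is concentrated on paths starting in \<open>v\<close>.
\<close>

definition play_measure ::
  "'v game \<Rightarrow> ('v list \<Rightarrow> 'v pmf) \<Rightarrow> ('v list \<Rightarrow> 'v pmf) \<Rightarrow> 'v \<Rightarrow> (nat \<Rightarrow> 'v) measure" where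
  "play_measure G \<pi>1 \<pi>2 v =
     projective_family.lim UNIV
       (Ionescu_Tulcea.CI (play_kernel G \<pi>1 \<pi>2 v) (\<lambda>_. count_space (verts G)))
       (\<lambda>_. count_space (verts G))"

definition play_prob ::
  "'v game \<Rightarrow> ('v list \<Rightarrow> 'v pmf) \<Rightarrow> ('v list \<Rightarrow> 'v pmf) \<Rightarrow> 'v \<Rightarrow> (nat \<Rightarrow> 'v) set \<Rightarrow> real" where
  "play_prob G \<pi>1 \<pi>2 v A = measure (play_measure G \<pi>1 \<pi>2 v) A"

definition fair_strategy2 :: "'v game \<Rightarrow> ('v list \<Rightarrow> 'v pmf) \<Rightarrow> bool" where
  "fair_strategy2 G \<pi>2 \<longleftrightarrow> strategy2 G \<pi>2 \<and>
     (\<forall>\<pi>1 u. strategy1 G \<pi>1 \<longrightarrow> u \<in> verts G \<longrightarrow> play_prob G \<pi>1 \<pi>2 u (fair_plays2 G) = 1)"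

definition stopping_under_fairness :: "'v game \<Rightarrow> bool" where
  "stopping_under_fairness G \<longleftrightarrow>
     (\<forall>\<pi>1 \<pi>2 v. strategy1 G \<pi>1 \<longrightarrow> fair_strategy2 G \<pi>2 \<longrightarrow> v \<in> verts G \<longrightarrow>
        play_prob G \<pi>1 \<pi>2 v (eventually_visits G (terminal_verts G)) = 1)"

definition exists_pre :: "'v game \<Rightarrow> 'v set \<Rightarrow> 'v set" where
  "exists_pre G C = {v \<in> verts G. (\<Sum>v'\<in>C. delta G v v') > 0}"

definition forall_pre :: "'v game \<Rightarrow> 'v set \<Rightarrow> 'v set" where
  "forall_pre G C = {v \<in> verts2 G \<union> vertsP G. (\<Sum>v'\<in>C. delta G v v') > 0} \<union>
     {v \<in> verts1 G. \<forall>v'\<in>verts G. delta G v v' > 0 \<longrightarrow> v' \<in> C}"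

text \<open>
  The closure accumulates the sets obtained so far, so that a vertex of Player 1 enters once
  all its successors have entered at any earlier stage.
\<close>

definition pre_star :: "('v set \<Rightarrow> 'v set) \<Rightarrow> 'v set \<Rightarrow> 'v set" where
  "pre_star P C = (\<Union>n. ((\<lambda>X. X \<union> P X) ^^ n) C)"

context stochastic_game
begin

lemma init_step_prob_sum:
  assumes "strategy1 G \<pi>1" "strategy2 G \<pi>2" "v \<in> verts G" "set h \<subseteq> verts G"
  shows "(\<Sum>u\<in>verts G. init_step_prob G \<pi>1 \<pi>2 v h u) = 1"
    and "u \<in> verts G \<Longrightarrow> 0 \<le> init_step_prob G \<pi>1 \<pi>2 v h u"
proof -
  have pmf1: "(\<Sum>u\<in>verts G. pmf (\<pi> h) u) = 1"
    if "strategy G W \<pi>" "h \<noteq> []" "last h \<in> W" for W \<pi>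
  proof -
    have "h = butlast h @ [last h]" using that by simp
    moreover have "set (butlast h) \<subseteq> verts G" using assms(4) by (auto dest: in_set_butlastD)
    ultimately have "set_pmf (\<pi> h) \<subseteq> post G (last h)"
      using that unfolding strategy_def by metis
    then show ?thesis
      by (intro sum_pmf_eq_1 finite_verts) (auto simp: post_def)
  qed
  have lastV: "last h \<in> verts G" if "h \<noteq> []" using that assms(4) by auto
  show "(\<Sum>u\<in>verts G. init_step_prob G \<pi>1 \<pi>2 v h u) = 1"
  proof (cases "h = []")
    case True
    then show ?thesis using assms(3) finite_verts by (simp add: init_step_prob_def)
  next
    case False
    consider "last h \<in> verts1 G" | "last h \<in> verts2 G" | "last h \<in> vertsP G"
      using lastV[OF False] verts_Un by auto
    then show ?thesis
    proof cases
      case 1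
      then show ?thesis
        using pmf1[OF assms(1) False] False by (simp add: init_step_prob_def step_prob_def)
    next
      case 2
      then have "last h \<notin> verts1 G" using verts_disjoint by auto
      then show ?thesis
        using 2 pmf1[OF assms(2) False] False by (simp add: init_step_prob_def step_prob_def)
    next
      case 3
      then have "last h \<notin> verts1 G" "last h \<notin> verts2 G" using verts_disjoint by auto
      then show ?thesis
        using 3 delta_prob False by (simp add: init_step_prob_def step_prob_def)
    qed
  qed
  show "0 \<le> init_step_prob G \<pi>1 \<pi>2 v h u" if "u \<in> verts G"
    using that lastV delta_range[of "last h" u] by (auto simp: init_step_prob_def step_prob_def)
qed

lemma Ionescu_Tulcea_play_kernel:
  assumes "strategy1 G \<pi>1" "strategy2 G \<pi>2" "v \<in> verts G"
  shows "Ionescu_Tulcea (play_kernel G \<pi>1 \<pi>2 v) (\<lambda>_. count_space (verts G))"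
proof -
  have space: "space (PiM {0..<i} (\<lambda>_. count_space (verts G))) = PiE {0..<i} (\<lambda>_. verts G)" for i :: nat
    by (simp add: space_PiM)
  have prob: "prob_space (play_kernel G \<pi>1 \<pi>2 v i \<omega>)"
    if "\<omega> \<in> PiE {0..<i} (\<lambda>_. verts G)" for i \<omega>
  proof (rule prob_spaceI)
    have h: "set (map \<omega> [0..<i]) \<subseteq> verts G" using that by auto
    show "emeasure (play_kernel G \<pi>1 \<pi>2 v i \<omega>) (space (play_kernel G \<pi>1 \<pi>2 v i \<omega>)) = 1"
      using init_step_prob_sum[OF assms h] finite_verts
      by (simp add: play_kernel_def space_point_measure emeasure_point_measure_finite sum_ennreal)
  qed
  have meas: "play_kernel G \<pi>1 \<pi>2 v i \<in> measurable (PiM {0..<i} (\<lambda>_. count_space (verts G)))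
      (subprob_algebra (count_space (verts G)))" for i
  proof -
    have "PiM {0..<i} (\<lambda>_. count_space (verts G)) = count_space (PiE {0..<i} (\<lambda>_. verts G))"
      by (intro count_space_PiM_finite) (auto intro: countable_finite finite_verts)
    then show ?thesis
      using prob by (auto simp: space_subprob_algebra play_kernel_def sets_point_measure
          intro!: prob_space_imp_subprob_space)
  qed
  show ?thesis
    by (rule Ionescu_Tulcea.intro[OF meas prob]) (simp add: space)
qed

lemma sets_play_measure [measurable_cong]:
  assumes "strategy1 G \<pi>1" "strategy2 G \<pi>2" "v \<in> verts G"
  shows "sets (play_measure G \<pi>1 \<pi>2 v) = sets (PiM UNIV (\<lambda>_. count_space (verts G)))"
proof -
  interpret IT: Ionescu_Tulcea "play_kernel G \<pi>1 \<pi>2 v" "\<lambda>_. count_space (verts G)"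
    by (rule Ionescu_Tulcea_play_kernel[OF assms])
  show ?thesis by (simp add: play_measure_def)
qed

lemma prob_space_play_measure:
  assumes "strategy1 G \<pi>1" "strategy2 G \<pi>2" "v \<in> verts G"
  shows "prob_space (play_measure G \<pi>1 \<pi>2 v)"
proof -
  interpret IT: Ionescu_Tulcea "play_kernel G \<pi>1 \<pi>2 v" "\<lambda>_. count_space (verts G)"
    by (rule Ionescu_Tulcea_play_kernel[OF assms])
  have eq: "emeasure IT.PF.lim (IT.PF.emb UNIV {} {\<lambda>_. undefined}) = 1"
  proof -
    have "emeasure IT.PF.lim (IT.PF.emb UNIV {} {\<lambda>_. undefined}) = emeasure (IT.CI {}) {\<lambda>_. undefined}"
      by (intro IT.lim) (auto simp: PiM_empty)
    also have "\<dots> = emeasure (IT.CI {}) (space (IT.CI {}))"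
      by (simp add: IT.PF.space_P PiM_empty)
    also have "\<dots> = 1"
      using prob_space.emeasure_space_1[OF IT.PF.prob_space_P[of "{}"]] by simp
    finally show ?thesis .
  qed
  have "IT.PF.emb UNIV {} {\<lambda>_. undefined} = space IT.PF.lim"
    by (simp add: prod_emb_def space_PiM PiE_UNIV_domain restrict_def)
  with eq show ?thesis
    unfolding play_measure_def by (intro prob_spaceI) simp
qed

lemma play_measure_cylinder:
  assumes "strategy1 G \<pi>1" "strategy2 G \<pi>2" "v \<in> verts G" "set xs \<subseteq> verts G"
  shows "emeasure (play_measure G \<pi>1 \<pi>2 v)
           {\<omega> \<in> UNIV \<rightarrow> verts G. \<forall>i<length xs. \<omega> i = xs ! i} =
         ennreal (\<Prod>i<length xs. init_step_prob G \<pi>1 \<pi>2 v (take i xs) (xs ! i))"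
proof -
  let ?M = "\<lambda>_::nat. count_space (verts G)"
  let ?K = "play_kernel G \<pi>1 \<pi>2 v"
  interpret IT: Ionescu_Tulcea ?K ?M
    by (rule Ionescu_Tulcea_play_kernel[OF assms(1-3)])
  define f where "f n = restrict ((!) xs) {0..<n}" for n
  have PiM: "PiM {0..<n} ?M = count_space (PiE {0..<n} (\<lambda>_. verts G))" for n :: nat
    by (intro count_space_PiM_finite) (auto intro: countable_finite finite_verts)
  have f_in: "f n \<in> PiE {0..<n} (\<lambda>_. verts G)" if "n \<le> length xs" for n
    using that assms(4) by (auto simp: f_def)
  have undef: "(\<lambda>_. undefined) \<in> space (PiM {0..<0} ?M)"
    by (simp add: space_PiM)
  have C: "emeasure (IT.C 0 n (\<lambda>_. undefined)) {f n} =
      ennreal (\<Prod>i<n. init_step_prob G \<pi>1 \<pi>2 v (take i xs) (xs ! i))" if "n \<le> length xs" for n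
    using that
  proof (induction n)
    case 0
    then show ?case by (simp add: f_def PiM_empty restrict_def)
  next
    case (Suc n)
    have n: "n < length xs" using Suc.prems by simp
    have fS: "f (Suc n) = (f n)(n := xs ! n)"
      by (auto simp: f_def fun_eq_iff restrict_def)
    have maps: "map (f n) [0..<n] = take n xs"
      using n by (intro nth_equalityI) (auto simp: f_def)
    have nth: "xs ! n \<in> verts G" using n assms(4) by auto
    have eP: "emeasure (IT.eP n \<omega>) {f (Suc n)} =
        ennreal (init_step_prob G \<pi>1 \<pi>2 v (take n xs) (xs ! n)) * indicator {f n} \<omega>"
      if w: "\<omega> \<in> space (PiM {0..<n} ?M)" for \<omega>
    proof -
      have w': "\<omega> \<in> PiE {0..<n} (\<lambda>_. verts G)" using w by (simp add: space_PiM)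
      have "emeasure (IT.eP n \<omega>) {f (Suc n)} =
          emeasure (?K n \<omega>) (fun_upd \<omega> n -` {f (Suc n)} \<inter> space (?M n))"
        using f_in[OF Suc.prems] by (intro IT.emeasure_eP w) (simp add: PiM)
      also have "fun_upd \<omega> n -` {f (Suc n)} \<inter> space (?M n) = (if \<omega> = f n then {xs ! n} else {})"
      proof -
        have "fun_upd \<omega> n x = (f n)(n := xs ! n) \<longleftrightarrow> \<omega> = f n \<and> x = xs ! n" for x
        proof
          assume eq: "fun_upd \<omega> n x = (f n)(n := xs ! n)"
          have "x = xs ! n" using fun_cong[OF eq, of n] by simp
          moreover have "\<omega> i = f n i" for i
            using fun_cong[OF eq, of i] PiE_arb[OF w', of n] by (cases "i = n") (auto simp: f_def)
          ultimately show "\<omega> = f n \<and> x = xs ! n" by auto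
        qed auto
        then show ?thesis using nth by (auto simp: fS)
      qed
      also have "emeasure (?K n \<omega>) (if \<omega> = f n then {xs ! n} else {}) =
          ennreal (init_step_prob G \<pi>1 \<pi>2 v (take n xs) (xs ! n)) * indicator {f n} \<omega>"
        using nth finite_verts maps by (simp add: play_kernel_def emeasure_point_measure_finite)
      finally show ?thesis .
    qed
    have take: "set (take n xs) \<subseteq> verts G" using assms(4) by (meson order_trans set_take_subset)
    have nn: "0 \<le> init_step_prob G \<pi>1 \<pi>2 v (take n xs) (xs ! n)"
      by (rule init_step_prob_sum(2)[OF assms(1-3) take nth])
    have "emeasure (IT.C 0 (Suc n) (\<lambda>_. undefined)) {f (Suc n)} =
        (\<integral>\<^sup>+\<omega>. emeasure (IT.eP n \<omega>) {f (Suc n)} \<partial>IT.C 0 n (\<lambda>_. undefined))"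
      using f_in[OF Suc.prems] undef IT.measurable_eP[of n]
      by (simp, subst emeasure_bind[where N="PiM {0..<Suc n} ?M"])
        (auto simp: IT.space_C PiM measurable_cong_sets[OF IT.sets_C refl] PiE_eq_empty_iff
          intro: f_in)
    also have "\<dots> = (\<integral>\<^sup>+\<omega>. ennreal (init_step_prob G \<pi>1 \<pi>2 v (take n xs) (xs ! n)) *
        indicator {f n} \<omega> \<partial>IT.C 0 n (\<lambda>_. undefined))"
      using undef by (intro nn_integral_cong eP) (simp add: IT.space_C)
    also have "\<dots> = ennreal (init_step_prob G \<pi>1 \<pi>2 v (take n xs) (xs ! n)) *
        emeasure (IT.C 0 n (\<lambda>_. undefined)) {f n}"
      using f_in[of n] n undef
      by (intro nn_integral_cmult_indicator) (simp add: IT.sets_C PiM)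
    also have "\<dots> = ennreal (\<Prod>i<Suc n. init_step_prob G \<pi>1 \<pi>2 v (take i xs) (xs ! i))"
      using Suc nn by (simp add: ennreal_mult' mult.commute)
    finally show ?case .
  qed
  let ?n = "length xs"
  have "{\<omega> \<in> UNIV \<rightarrow> verts G. \<forall>i<?n. \<omega> i = xs ! i} = prod_emb UNIV ?M {0..<?n} {f ?n}"
    by (auto simp: prod_emb_def space_PiM f_def PiE_UNIV_domain restrict_def fun_eq_iff) metis
  moreover have "{f ?n} \<in> sets (PiM {0..<?n} ?M)" using f_in by (simp add: PiM)
  ultimately show ?thesis
    using C[of ?n] IT.lim[of "{0..<?n}" "{f ?n}"] IT.emeasure_CI[of "{0..<?n}" ?n "{f ?n}"]
      f_in[of ?n] by (simp add: play_measure_def prod_emb_id PiM)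
qed

lemma AE_play_measure_paths:
  assumes "strategy1 G \<pi>1" "strategy2 G \<pi>2" "v \<in> verts G"
  shows "AE \<omega> in play_measure G \<pi>1 \<pi>2 v. \<omega> \<in> paths G \<and> \<omega> 0 = v"
proof -
  let ?p = "init_step_prob G \<pi>1 \<pi>2 v"
  define Z where "Z = {xs. set xs \<subseteq> verts G \<and> (\<exists>i<length xs. ?p (take i xs) (xs ! i) = 0)}"
  have space: "space (play_measure G \<pi>1 \<pi>2 v) = UNIV \<rightarrow> verts G"
    using sets_eq_imp_space_eq[OF sets_play_measure[OF assms]]
    by (simp add: space_PiM PiE_UNIV_domain)
  have "Z \<subseteq> lists (verts G)" by (auto simp: Z_def)
  then have "countable Z"
    by (rule countable_subset) (intro countable_lists countable_finite finite_verts)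
  moreover have "AE \<omega> in play_measure G \<pi>1 \<pi>2 v. \<not> (\<forall>i<length xs. \<omega> i = xs ! i)" if "xs \<in> Z" for xs
  proof -
    have "(\<Prod>i<length xs. ?p (take i xs) (xs ! i)) = 0"
      using that by (auto simp: Z_def)
    then have null: "emeasure (play_measure G \<pi>1 \<pi>2 v)
        {\<omega> \<in> UNIV \<rightarrow> verts G. \<forall>i<length xs. \<omega> i = xs ! i} = 0"
      using play_measure_cylinder[OF assms, of xs] that by (simp only: Z_def mem_Collect_eq ennreal_0)
    have "{\<omega> \<in> space (PiM UNIV (\<lambda>_. count_space (verts G))). \<forall>i<length xs. \<omega> i = xs ! i}
        \<in> sets (PiM UNIV (\<lambda>_. count_space (verts G)))"
    proof (intro sets.sets_Collect_countable_All sets.sets_Collect_imp sets.sets_Collect_const)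
      fix i
      have "(\<lambda>\<omega>. \<omega> i) -` {xs ! i} \<inter> space (PiM UNIV (\<lambda>_. count_space (verts G)))
          = (\<lambda>\<omega>. \<omega> i) -` ({xs ! i} \<inter> verts G) \<inter> space (PiM UNIV (\<lambda>_. count_space (verts G)))"
        by (auto simp: space_PiM)
      also have "\<dots> \<in> sets (PiM UNIV (\<lambda>_. count_space (verts G)))"
        by (rule measurable_sets[OF measurable_component_singleton]) auto
      finally show "{\<omega> \<in> space (PiM UNIV (\<lambda>_. count_space (verts G))). \<omega> i = xs ! i}
          \<in> sets (PiM UNIV (\<lambda>_. count_space (verts G)))"
        by (simp add: vimage_def Int_def conj_commute)
    qed
    then have "{\<omega> \<in> UNIV \<rightarrow> verts G. \<forall>i<length xs. \<omega> i = xs ! i} \<in> sets (play_measure G \<pi>1 \<pi>2 v)"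
      unfolding sets_play_measure[OF assms] space_PiM space_count_space PiE_UNIV_domain .
    with null have "{\<omega> \<in> UNIV \<rightarrow> verts G. \<forall>i<length xs. \<omega> i = xs ! i}
        \<in> null_sets (play_measure G \<pi>1 \<pi>2 v)" by (rule null_setsI)
    then show ?thesis
      by (rule AE_I') (unfold space, blast)
  qed
  ultimately have "AE \<omega> in play_measure G \<pi>1 \<pi>2 v. \<forall>xs\<in>Z. \<not> (\<forall>i<length xs. \<omega> i = xs ! i)"
    by (simp add: AE_ball_countable)
  with AE_space show ?thesis
  proof eventually_elim
    fix \<omega> assume "\<omega> \<in> space (play_measure G \<pi>1 \<pi>2 v)"
      and Z: "\<forall>xs\<in>Z. \<not> (\<forall>i<length xs. \<omega> i = xs ! i)"
    then have in_V: "\<omega> k \<in> verts G" for k by (auto simp: space)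
    have nz: "?p (map \<omega> [0..<n]) (\<omega> n) \<noteq> 0" for n
    proof
      assume "?p (map \<omega> [0..<n]) (\<omega> n) = 0"
      then have "map \<omega> [0..<Suc n] \<in> Z"
        using in_V unfolding Z_def by (auto intro!: exI[of _ n] simp: nth_append)
      moreover have "\<forall>i<length (map \<omega> [0..<Suc n]). \<omega> i = map \<omega> [0..<Suc n] ! i"
        by (auto simp del: upt_Suc)
      ultimately show False using Z by blast
    qed
    have "delta G (\<omega> k) (\<omega> (Suc k)) > 0" for k
    proof (rule ccontr)
      assume neg: "\<not> delta G (\<omega> k) (\<omega> (Suc k)) > 0"
      then have "\<omega> (Suc k) \<notin> post G (\<omega> k)" by (simp add: post_def)
      moreover have "set_pmf (\<pi> (map \<omega> [0..<k] @ [\<omega> k])) \<subseteq> post G (\<omega> k)"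
        if "strategy G W \<pi>" "\<omega> k \<in> W" for W \<pi>
      proof -
        have "set (map \<omega> [0..<k]) \<subseteq> verts G" using in_V by auto
        with that show ?thesis unfolding strategy_def by blast
      qed
      ultimately have "pmf (\<pi> (map \<omega> [0..<k] @ [\<omega> k])) (\<omega> (Suc k)) = 0"
        if "strategy G W \<pi>" "\<omega> k \<in> W" for W \<pi>
        using that by (auto simp: pmf_eq_0_set_pmf)
      moreover have "delta G (\<omega> k) (\<omega> (Suc k)) = 0"
        using neg delta_range[OF in_V[of k] in_V[of "Suc k"]] by simp
      ultimately have "?p (map \<omega> [0..<Suc k]) (\<omega> (Suc k)) = 0"
        using assms(1,2) by (auto simp: init_step_prob_def step_prob_def)
      with nz show False by blast
    qed
    moreover have "\<omega> 0 = v"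
      using nz[of 0] by (auto simp: init_step_prob_def split: if_splits)
    ultimately show "\<omega> \<in> paths G \<and> \<omega> 0 = v"
      using in_V by (simp add: paths_def)
  qed
qed

end

end

theory Submission
  imports Defs
begin

text \<open>
  Almost surely the set of vertices visited infinitely often contains, with a vertex of Player 2
  (by fairness) or a probabilistic vertex (by a Borel--Cantelli argument), all its successors,
  and with a vertex of Player 1 some successor. Such a set meets
  \<open>\<forall>Pre\<^sub>f\<^sup>*(T)\<close> only if it meets \<open>T\<close>, which gives one direction. For the other one, let
  Player 2 choose uniformly among all successors, which is fair by the same Borel--Cantelli
  argument, and let Player 1 do the same until \<open>B = V - \<forall>Pre\<^sub>f\<^sup>*(T)\<close> is reached, and then
  stay in \<open>B\<close>, which is possible because every Player 1 vertex of \<open>B\<close> has a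
  successor in \<open>B\<close> and all other vertices of \<open>B\<close> have all their successors there.
\<close>

section \<open>Iterated closures of an arbitrary operator\<close>

lemma subset_pre_star: "C \<subseteq> pre_star P C"
proof -
  have "((\<lambda>X. X \<union> P X) ^^ 0) C \<subseteq> pre_star P C"
    unfolding pre_star_def by blast
  then show ?thesis by simp
qed

text \<open>Assuming invariance for every subset \<open>X\<close> of \<open>D\<close> takes the
  place of monotonicity of \<open>P\<close>: it applies to each iterate in turn.\<close>

lemma pre_star_least:
  assumes "C \<subseteq> D" and "\<And>X. X \<subseteq> D \<Longrightarrow> P X \<subseteq> D"
  shows "pre_star P C \<subseteq> D"
proof -
  have "((\<lambda>X. X \<union> P X) ^^ n) C \<subseteq> D" for n
    by (induction n) (use assms in auto)
  then show ?thesis by (auto simp: pre_star_def)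
qed

text \<open>The iterates increase, so a finite union of them is already attained at a single stage,
  and one more application of \<open>P\<close> leads into the next stage.\<close>

lemma pre_star_closed:
  assumes "finite (pre_star P C)"
  shows "P (pre_star P C) \<subseteq> pre_star P C"
proof -
  let ?C = "\<lambda>n. ((\<lambda>X. X \<union> P X) ^^ n) C"
  have mono: "incseq ?C"
    by (rule incseq_SucI) auto
  have "\<exists>n. S \<subseteq> ?C n" if "finite S" "S \<subseteq> pre_star P C" for S
    using that
  proof (induction S)
    case (insert x S)
    then obtain m n where "S \<subseteq> ?C m" "x \<in> ?C n"
      by (auto simp: pre_star_def)
    then have "insert x S \<subseteq> ?C (max m n)"
      using incseqD[OF mono, of m "max m n"] incseqD[OF mono, of n "max m n"] by auto
    then show ?case by blast
  qed simp
  then obtain n where "pre_star P C \<subseteq> ?C n"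
    using assms by blast
  then have "pre_star P C = ?C n"
    by (auto simp: pre_star_def)
  then have "P (pre_star P C) \<subseteq> ?C (Suc n)" by simp
  then show ?thesis unfolding pre_star_def by blast
qed

section \<open>The predecessor operators on the successor graph\<close>

context stochastic_game
begin

lemma post_subset_verts: "post G v \<subseteq> verts G"
  by (auto simp: post_def)

lemma finite_post: "finite (post G v)"
  using post_subset_verts finite_verts by (rule finite_subset)

text \<open>A sum of nonnegative terms vanishes only if every term does. This turns both operators
  into conditions on \<open>post\<close>, in which the numerical values of \<open>delta\<close> no
  longer occur.\<close>

lemma sum_delta_pos_iff:
  assumes "v \<in> verts G" "C \<subseteq> verts G"
  shows "(\<Sum>v'\<in>C. delta G v v') > 0 \<longleftrightarrow> post G v \<inter> C \<noteq> {}"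
proof -
  have "finite C" using assms(2) finite_verts by (rule finite_subset)
  moreover have nn: "0 \<le> delta G v v'" if "v' \<in> C" for v'
    using that delta_range[of v v'] assms by auto
  ultimately have "(\<Sum>v'\<in>C. delta G v v') = 0 \<longleftrightarrow> (\<forall>v'\<in>C. delta G v v' = 0)"
    by (intro sum_nonneg_eq_0_iff)
  moreover have "(\<Sum>v'\<in>C. delta G v v') \<ge> 0"
    by (rule sum_nonneg) (rule nn)
  moreover have "(\<forall>v'\<in>C. delta G v v' = 0) \<longleftrightarrow> post G v \<inter> C = {}"
    using assms nn by (force simp: post_def)
  ultimately show ?thesis by linarith
qed

lemma exists_pre_eq:
  "C \<subseteq> verts G \<Longrightarrow> exists_pre G C = {v \<in> verts G. post G v \<inter> C \<noteq> {}}"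
  using sum_delta_pos_iff by (auto simp: exists_pre_def)

lemma forall_pre_eq:
  assumes "C \<subseteq> verts G"
  shows "forall_pre G C =
    {v \<in> verts2 G \<union> vertsP G. post G v \<inter> C \<noteq> {}} \<union> {v \<in> verts1 G. post G v \<subseteq> C}"
proof -
  have "{v \<in> verts2 G \<union> vertsP G. (\<Sum>v'\<in>C. delta G v v') > 0} =
      {v \<in> verts2 G \<union> vertsP G. post G v \<inter> C \<noteq> {}}"
    using sum_delta_pos_iff[OF _ assms] verts_Un by blast
  moreover have "{v \<in> verts1 G. \<forall>v'\<in>verts G. delta G v v' > 0 \<longrightarrow> v' \<in> C} =
      {v \<in> verts1 G. post G v \<subseteq> C}"
    by (auto simp: post_def)
  ultimately show ?thesis by (simp add: forall_pre_def)
qed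

lemma pre_star_exists_pre_subset:
  "C \<subseteq> verts G \<Longrightarrow> pre_star (exists_pre G) C \<subseteq> verts G"
  by (rule pre_star_least) (auto simp: exists_pre_def)

lemma pre_star_forall_pre_subset:
  "C \<subseteq> verts G \<Longrightarrow> pre_star (forall_pre G) C \<subseteq> verts G"
  by (rule pre_star_least) (auto simp: forall_pre_def verts_Un)

text \<open>Closedness read contrapositively: no edge leads from the complement of the closure back
  into it, so the complement is a trap.\<close>

lemma post_pre_star_exists_pre:
  assumes "C \<subseteq> verts G" "v \<in> verts G" "v \<notin> pre_star (exists_pre G) C"
  shows "post G v \<inter> pre_star (exists_pre G) C = {}"
proof -
  have "exists_pre G (pre_star (exists_pre G) C) \<subseteq> pre_star (exists_pre G) C"
    by (intro pre_star_closed finite_subset[OF pre_star_exists_pre_subset] assms(1) finite_verts)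
  then show ?thesis
    using assms exists_pre_eq[OF pre_star_exists_pre_subset[OF assms(1)]] by auto
qed

text \<open>The path meets \<open>C\<close> only at its last vertex. This matters later: the
  strategy built for Player 1 is uniform over all successors only before \<open>C\<close> is
  reached.\<close>

lemma pre_star_exists_pre_path:
  assumes "C \<subseteq> verts G" "v \<in> pre_star (exists_pre G) C"
  obtains xs where "xs \<noteq> []" "hd xs = v" "last xs \<in> C" "set xs \<subseteq> verts G"
    "\<And>i. Suc i < length xs \<Longrightarrow> xs ! i \<notin> C \<and> xs ! Suc i \<in> post G (xs ! i)"
proof -
  define ok where "ok xs \<longleftrightarrow> xs \<noteq> [] \<and> last xs \<in> C \<and> set xs \<subseteq> verts G \<and>
    (\<forall>i. Suc i < length xs \<longrightarrow> xs ! i \<notin> C \<and> xs ! Suc i \<in> post G (xs ! i))" for xs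
  define D where "D = {v \<in> verts G. \<exists>xs. ok xs \<and> hd xs = v}"
  have C: "v \<in> D" if "v \<in> C" for v
    using that assms(1) by (auto simp: D_def ok_def intro!: exI[of _ "[v]"])
  have "pre_star (exists_pre G) C \<subseteq> D"
  proof (rule pre_star_least)
    fix X assume X: "X \<subseteq> D"
    then have "X \<subseteq> verts G" by (auto simp: D_def)
    show "exists_pre G X \<subseteq> D"
    proof
      fix v assume "v \<in> exists_pre G X"
      then obtain w where w: "v \<in> verts G" "w \<in> post G v" "w \<in> X"
        using exists_pre_eq[OF \<open>X \<subseteq> verts G\<close>] by auto
      then obtain xs where xs: "ok xs" "hd xs = w"
        using X by (auto simp: D_def)
      show "v \<in> D"
      \<comment> \<open>If \<open>v\<close> is already in \<open>C\<close>, the path is cut to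
        \<open>[v]\<close>; prepending \<open>v\<close> would break the condition that earlier
        vertices avoid \<open>C\<close>.\<close>
      proof (cases "v \<in> C")
        case False
        have "ok (v # xs)"
          using xs w False by (auto simp: ok_def nth_Cons hd_conv_nth split: nat.splits)
        then show ?thesis using w by (auto simp: D_def)
      qed (rule C)
    qed
  qed (use C in auto)
  then show thesis
    using assms(2) that by (auto simp: D_def ok_def)
qed

text \<open>Closedness again, negated: Player 1 can remain in the complement of the closure, and no
  other vertex there has an edge leaving it.\<close>

lemma not_in_pre_star_forall_pre:
  assumes "C \<subseteq> verts G" "v \<in> verts G" "v \<notin> pre_star (forall_pre G) C"
  shows "v \<in> verts1 G \<Longrightarrow> \<not> post G v \<subseteq> pre_star (forall_pre G) C"
    and "v \<notin> verts1 G \<Longrightarrow> post G v \<inter> pre_star (forall_pre G) C = {}"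
proof -
  have "forall_pre G (pre_star (forall_pre G) C) \<subseteq> pre_star (forall_pre G) C"
    by (intro pre_star_closed finite_subset[OF pre_star_forall_pre_subset] assms(1) finite_verts)
  then show "v \<in> verts1 G \<Longrightarrow> \<not> post G v \<subseteq> pre_star (forall_pre G) C"
    and "v \<notin> verts1 G \<Longrightarrow> post G v \<inter> pre_star (forall_pre G) C = {}"
    using assms forall_pre_eq[OF pre_star_forall_pre_subset[OF assms(1)]] verts_Un by auto
qed

section \<open>Limit sets of paths\<close>

lemma path_post: "\<omega> \<in> paths G \<Longrightarrow> \<omega> (Suc k) \<in> post G (\<omega> k)"
  by (simp add: paths_def post_def)

lemma inf_verts_nonempty:
  assumes "\<omega> \<in> paths G"
  shows "inf_verts \<omega> \<noteq> {}"
proof -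
  have "finite (range \<omega>)"
    using assms by (intro finite_subset[OF _ finite_verts]) (auto simp: paths_def)
  from pigeonhole_infinite[OF infinite_UNIV_nat this] show ?thesis
    by (auto simp: inf_verts_def INFM_iff_infinite)
qed

text \<open>Pigeonhole on the visits to \<open>u\<close>: finitely many vertices can follow, so one
  of them follows infinitely often.\<close>

lemma inf_verts_post:
  assumes "\<omega> \<in> paths G" "u \<in> inf_verts \<omega>"
  shows "post G u \<inter> inf_verts \<omega> \<noteq> {}"
proof -
  let ?A = "{k. \<omega> k = u}"
  have "infinite ?A"
    using assms(2) by (simp add: inf_verts_def INFM_iff_infinite)
  moreover have "finite ((\<lambda>k. \<omega> (Suc k)) ` ?A)"
    using assms(1) by (intro finite_subset[OF _ finite_verts]) (auto simp: paths_def)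
  ultimately obtain k where k: "\<omega> k = u" "infinite {j \<in> ?A. \<omega> (Suc j) = \<omega> (Suc k)}"
    using pigeonhole_infinite[of ?A "\<lambda>k. \<omega> (Suc k)"] by auto
  then have "infinite (Suc ` {j \<in> ?A. \<omega> (Suc j) = \<omega> (Suc k)})"
    by (simp add: finite_image_iff)
  moreover have "Suc ` {j \<in> ?A. \<omega> (Suc j) = \<omega> (Suc k)} \<subseteq> {j. \<omega> j = \<omega> (Suc k)}"
    by auto
  ultimately have "infinite {j. \<omega> j = \<omega> (Suc k)}"
    by (rule infinite_super[rotated])
  then have "\<omega> (Suc k) \<in> inf_verts \<omega>"
    by (simp add: inf_verts_def INFM_iff_infinite)
  moreover have "\<omega> (Suc k) \<in> post G u"
    using path_post[OF assms(1), of k] k by simp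
  ultimately show ?thesis by blast
qed

text \<open>The complement of the limit set is invariant under \<open>forall_pre\<close>: a vertex
  of the limit set keeps some successor inside it if it belongs to Player 1, and all of them
  otherwise. It is used contrapositively: a limit set meeting the closure meets
  \<open>C\<close>.\<close>

lemma inf_verts_disjoint_pre_star:
  assumes "\<omega> \<in> paths G" "inf_verts \<omega> \<inter> C = {}" "C \<subseteq> verts G"
    and fair: "\<And>u. u \<in> (verts2 G \<union> vertsP G) \<inter> inf_verts \<omega> \<Longrightarrow> post G u \<subseteq> inf_verts \<omega>"
  shows "inf_verts \<omega> \<inter> pre_star (forall_pre G) C = {}"
proof -
  have "pre_star (forall_pre G) C \<subseteq> verts G - inf_verts \<omega>"
  proof (rule pre_star_least)
    fix X assume X: "X \<subseteq> verts G - inf_verts \<omega>"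
    then have "X \<subseteq> verts G" by auto
    show "forall_pre G X \<subseteq> verts G - inf_verts \<omega>"
      using X fair inf_verts_post[OF assms(1)] verts_Un
      unfolding forall_pre_eq[OF \<open>X \<subseteq> verts G\<close>] by blast
  qed (use assms in auto)
  then show ?thesis by blast
qed

lemma terminal_verts_subset: "terminal_verts G \<subseteq> verts G"
  by (auto simp: terminal_verts_def)

lemma path_terminal:
  assumes "\<omega> \<in> paths G" "\<omega> k \<in> terminal_verts G" "k \<le> n"
  shows "\<omega> n \<in> terminal_verts G"
  using assms(3)
proof (induction n rule: dec_induct)
  case (step n)
  have "delta G (\<omega> n) (\<omega> (Suc n)) > 0" "\<omega> (Suc n) \<in> verts G"
    using assms(1) by (auto simp: paths_def)
  then have "\<omega> (Suc n) = \<omega> n"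
    using step.IH by (force simp: terminal_verts_def)
  then show ?case using step.IH by simp
qed (rule assms(2))

text \<open>Covers the memoryless uniform strategies of both players that serve as witnesses
  below.\<close>

lemma strategy_pmf_of_set:
  assumes "W \<subseteq> verts G" and "\<And>u. u \<in> verts G \<Longrightarrow> A u \<noteq> {} \<and> A u \<subseteq> post G u"
  shows "strategy G W (\<lambda>h. pmf_of_set (A (last h)))"
  unfolding strategy_def
proof (intro allI impI)
  fix h u assume "u \<in> W"
  then have "A u \<noteq> {}" "A u \<subseteq> post G u" using assms by auto
  moreover from this have "finite (A u)" using finite_post finite_subset by blast
  ultimately show "set_pmf (pmf_of_set (A (last (h @ [u])))) \<subseteq> post G u"
    by simp
qed

end

section \<open>The probability space of plays under fixed strategies\<close>

locale play = stochastic_game +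
  fixes \<pi>1 \<pi>2 and v :: 'a
  assumes strategy1: "strategy1 G \<pi>1" and strategy2: "strategy2 G \<pi>2" and init: "v \<in> verts G"
begin

abbreviation M :: "(nat \<Rightarrow> 'a) measure" where
  "M \<equiv> play_measure G \<pi>1 \<pi>2 v"

abbreviation p :: "'a list \<Rightarrow> 'a \<Rightarrow> real" where
  "p \<equiv> init_step_prob G \<pi>1 \<pi>2 v"

sublocale prob_space M
  by (rule prob_space_play_measure[OF strategy1 strategy2 init])

lemmas sets_M = sets_play_measure[OF strategy1 strategy2 init]

lemma space_M: "space M = UNIV \<rightarrow> verts G"
  using sets_eq_imp_space_eq[OF sets_M] by (simp add: space_PiM PiE_UNIV_domain)

lemma measurable_vertex [measurable]: "(\<lambda>\<omega>. \<omega> i) \<in> measurable M (count_space (verts G))"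
  unfolding measurable_cong_sets[OF sets_M refl] by measurable

lemma measurable_eq_vertex [measurable]: "Measurable.pred M (\<lambda>\<omega>. \<omega> i = a)"
  by (rule measurable_compose[OF measurable_vertex]) simp

lemma measurable_inf_verts [measurable]: "Measurable.pred M (\<lambda>\<omega>. a \<in> inf_verts \<omega>)"
  unfolding inf_verts_def INFM_nat mem_Collect_eq by measurable

definition cyl :: "'a list \<Rightarrow> (nat \<Rightarrow> 'a) set" where
  "cyl xs = {\<omega> \<in> UNIV \<rightarrow> verts G. \<forall>i<length xs. \<omega> i = xs ! i}"

lemma cyl_sets [measurable]: "cyl xs \<in> sets M"
proof -
  have "cyl xs = {\<omega> \<in> space M. \<forall>i<length xs. \<omega> i = xs ! i}"
    by (simp add: cyl_def space_M)
  also have "\<dots> \<in> sets M" by measurable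
  finally show ?thesis .
qed

lemma emeasure_cyl:
  "set xs \<subseteq> verts G \<Longrightarrow> emeasure M (cyl xs) = ennreal (\<Prod>i<length xs. p (take i xs) (xs ! i))"
  unfolding cyl_def by (rule play_measure_cylinder[OF strategy1 strategy2 init])

lemmas p_sum = init_step_prob_sum(1)[OF strategy1 strategy2 init]
lemmas p_nonneg = init_step_prob_sum(2)[OF strategy1 strategy2 init]

text \<open>So \<open>p xs y\<close> acts as the conditional probability of \<open>y\<close> given
  the history \<open>xs\<close>; the product form also covers null cylinders.\<close>

lemma emeasure_cyl_snoc:
  assumes "set xs \<subseteq> verts G" "y \<in> verts G"
  shows "emeasure M (cyl (xs @ [y])) = emeasure M (cyl xs) * ennreal (p xs y)"
proof -
  have "(\<Prod>i<length xs. p (take i (xs @ [y])) ((xs @ [y]) ! i)) =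
      (\<Prod>i<length xs. p (take i xs) (xs ! i))"
    by (intro prod.cong) (auto simp: nth_append)
  then show ?thesis
    using assms p_nonneg[OF assms] by (simp add: emeasure_cyl ennreal_mult'')
qed

lemma hist_verts: "\<omega> \<in> space M \<Longrightarrow> set (map \<omega> [0..<n]) \<subseteq> verts G"
  by (auto simp: space_M)

text \<open>The cylinders over lists of length \<open>n\<close> partition the space into finitely
  many pieces, on each of which the integrand is constant.\<close>

lemma nn_integral_hist:
  fixes f :: "'a list \<Rightarrow> ennreal"
  shows "(\<integral>\<^sup>+\<omega>. f (map \<omega> [0..<n]) \<partial>M) =
    (\<Sum>xs | set xs \<subseteq> verts G \<and> length xs = n. f xs * emeasure M (cyl xs))"
proof -
  let ?L = "{xs. set xs \<subseteq> verts G \<and> length xs = n}"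
  have fin: "finite ?L" by (intro finite_lists_length_eq finite_verts)
  have "(\<integral>\<^sup>+\<omega>. f (map \<omega> [0..<n]) \<partial>M) = (\<integral>\<^sup>+\<omega>. (\<Sum>xs\<in>?L. f xs * indicator (cyl xs) \<omega>) \<partial>M)"
  proof (rule nn_integral_cong)
    fix \<omega> assume \<omega>: "\<omega> \<in> space M"
    have "\<omega> \<in> cyl xs \<longleftrightarrow> map \<omega> [0..<n] = xs" if "xs \<in> ?L" for xs
      using that \<omega> by (auto simp: cyl_def space_M list_eq_iff_nth_eq)
    then have "(\<Sum>xs\<in>?L. f xs * indicator (cyl xs) \<omega>) =
        (\<Sum>xs\<in>?L. if map \<omega> [0..<n] = xs then f xs else 0)"
      by (intro sum.cong) (auto simp: indicator_def)
    also have "\<dots> = f (map \<omega> [0..<n])"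
      using fin hist_verts[OF \<omega>, of n] by (simp add: sum.delta')
    finally show "f (map \<omega> [0..<n]) = (\<Sum>xs\<in>?L. f xs * indicator (cyl xs) \<omega>)" by simp
  qed
  also have "\<dots> = (\<Sum>xs\<in>?L. \<integral>\<^sup>+\<omega>. f xs * indicator (cyl xs) \<omega> \<partial>M)"
    by (intro nn_integral_sum) measurable
  also have "\<dots> = (\<Sum>xs\<in>?L. f xs * emeasure M (cyl xs))"
    by (intro sum.cong nn_integral_cmult_indicator) auto
  finally show ?thesis .
qed

text \<open>The tower property, with the conditional expectation given the history as an explicit
  finite sum. The proof regards the integrand as a function of the history of length
  \<open>Suc n\<close>, split into \<open>butlast\<close> and \<open>last\<close>.\<close>

lemma nn_integral_hist_Suc:
  fixes f :: "'a list \<Rightarrow> 'a \<Rightarrow> ennreal"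
  shows "(\<integral>\<^sup>+\<omega>. f (map \<omega> [0..<n]) (\<omega> n) \<partial>M) =
    (\<integral>\<^sup>+\<omega>. (\<Sum>y\<in>verts G. f (map \<omega> [0..<n]) y * ennreal (p (map \<omega> [0..<n]) y)) \<partial>M)"
proof -
  let ?L = "\<lambda>n. {xs. set xs \<subseteq> verts G \<and> length xs = n}"
  have bij: "bij_betw (\<lambda>(xs, y). xs @ [y]) (?L n \<times> verts G) (?L (Suc n))"
    by (rule bij_betwI[where g = "\<lambda>xs. (butlast xs, last xs)"])
      (auto simp: append_butlast_last_id simp flip: length_greater_0_conv dest: in_set_butlastD
        intro!: subsetD[OF _ last_in_set])
  have "(\<integral>\<^sup>+\<omega>. f (map \<omega> [0..<n]) (\<omega> n) \<partial>M) =
      (\<integral>\<^sup>+\<omega>. (\<lambda>xs. f (butlast xs) (last xs)) (map \<omega> [0..<Suc n]) \<partial>M)"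
    by simp
  also have "\<dots> = (\<Sum>xs\<in>?L (Suc n). f (butlast xs) (last xs) * emeasure M (cyl xs))"
    by (rule nn_integral_hist)
  also have "\<dots> = (\<Sum>(xs, y)\<in>?L n \<times> verts G. f xs y * emeasure M (cyl (xs @ [y])))"
    by (subst sum.reindex_bij_betw[OF bij, symmetric]) (simp add: case_prod_beta)
  also have "\<dots> = (\<Sum>xs\<in>?L n. \<Sum>y\<in>verts G. f xs y * emeasure M (cyl (xs @ [y])))"
    by (simp add: sum.cartesian_product)
  also have "\<dots> = (\<Sum>xs\<in>?L n. (\<Sum>y\<in>verts G. f xs y * ennreal (p xs y)) * emeasure M (cyl xs))"
    by (intro sum.cong refl) (simp add: emeasure_cyl_snoc sum_distrib_left mult_ac)
  also have "\<dots> = (\<integral>\<^sup>+\<omega>. (\<Sum>y\<in>verts G. f (map \<omega> [0..<n]) y * ennreal (p (map \<omega> [0..<n]) y)) \<partial>M)"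
    by (rule nn_integral_hist[symmetric])
  finally show ?thesis .
qed

text \<open>There are countably many histories, and the preimage of each is a cylinder or empty.
  Hence every function of a history is measurable.\<close>

lemma measurable_hist [measurable]:
  "(\<lambda>\<omega>. map \<omega> [0..<n]) \<in> measurable M (count_space (lists (verts G)))"
proof (subst measurable_count_space_eq_countable)
  show "countable (lists (verts G))"
    by (intro countable_lists countable_finite finite_verts)
  have "(\<lambda>\<omega>. map \<omega> [0..<n]) -` {xs} \<inter> space M \<in> sets M" if "xs \<in> lists (verts G)" for xs
  proof -
    have "(\<lambda>\<omega>. map \<omega> [0..<n]) -` {xs} \<inter> space M = (if length xs = n then cyl xs else {})"
      unfolding cyl_def space_M vimage_def by (auto simp: list_eq_iff_nth_eq)
    then show ?thesis by simp
  qed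
  then show "(\<lambda>\<omega>. map \<omega> [0..<n]) \<in> space M \<rightarrow> lists (verts G) \<and>
      (\<forall>a\<in>lists (verts G). (\<lambda>\<omega>. map \<omega> [0..<n]) -` {a} \<inter> space M \<in> sets M)"
    using hist_verts[of _ n] by (simp only: Pi_iff in_lists_conv_set subset_iff) blast
qed

text \<open>The indicator of a step of probability zero integrates to zero by
  \<open>nn_integral_hist_Suc\<close>. Unlike membership in \<open>paths G\<close>, this forces
  plays to follow the support of the chosen strategies.\<close>

lemma AE_step_nonzero: "AE \<omega> in M. \<forall>n. p (map \<omega> [0..<n]) (\<omega> n) \<noteq> 0"
proof (rule AE_all_countable[THEN iffD2], rule allI)
  fix n
  let ?f = "\<lambda>h y. if p h y = 0 then 1 else 0 :: ennreal"
  have "(\<lambda>\<omega>. (\<lambda>xs. ?f (butlast xs) (last xs)) (map \<omega> [0..<Suc n])) \<in> borel_measurable M"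
    by (rule measurable_compose[OF measurable_hist]) simp
  then have meas: "(\<lambda>\<omega>. ?f (map \<omega> [0..<n]) (\<omega> n)) \<in> borel_measurable M"
    by simp
  have "(\<integral>\<^sup>+\<omega>. ?f (map \<omega> [0..<n]) (\<omega> n) \<partial>M) =
      (\<integral>\<^sup>+\<omega>. (\<Sum>y\<in>verts G. ?f (map \<omega> [0..<n]) y * ennreal (p (map \<omega> [0..<n]) y)) \<partial>M)"
    by (rule nn_integral_hist_Suc)
  also have "\<dots> = (\<integral>\<^sup>+\<omega>. 0 \<partial>M)"
    by (intro nn_integral_cong sum.neutral) auto
  finally have "AE \<omega> in M. ?f (map \<omega> [0..<n]) (\<omega> n) = 0"
    using nn_integral_0_iff_AE[OF meas] by simp
  then show "AE \<omega> in M. p (map \<omega> [0..<n]) (\<omega> n) \<noteq> 0"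
    by eventually_elim (simp split: if_splits)
qed

text \<open>
  A Borel--Cantelli lemma without independence. For a lower bound \<open>c < 1\<close> of the step probability,
  let \<open>X n N\<close> be the factor \<open>1 / (1 - c)\<close> to the number of visits to \<open>u\<close> in \<open>{n..<N}\<close>,
  or 0 once such a visit is followed by \<open>w\<close>. This is a supermartingale in \<open>N\<close>, so by
  Fatou's lemma its lower limit is almost surely finite, but it tends to infinity if \<open>u\<close> is
  visited infinitely often and \<open>w\<close> is not visited after time \<open>n\<close>.
\<close>

lemma AE_inf_verts_step:
  assumes e: "0 < e"
    and step: "\<And>h. set h \<subseteq> verts G \<Longrightarrow> h \<noteq> [] \<Longrightarrow> last h = u \<Longrightarrow> e \<le> p h w"
    and w: "w \<in> verts G"
  shows "AE \<omega> in M. u \<in> inf_verts \<omega> \<longrightarrow> w \<in> inf_verts \<omega>"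
proof -
  \<comment> \<open>The bound 1/2 keeps \<open>1 - c\<close> positive even when \<open>e\<close> is
    at least 1.\<close>
  define c where "c = min e (1/2)"
  have c: "0 < c" "c < 1" "c \<le> e" using e by (auto simp: c_def)
  define fac :: "'a \<Rightarrow> 'a \<Rightarrow> ennreal" where
    "fac x y = (if x = u then if y = w then 0 else ennreal (1 / (1 - c)) else 1)" for x y
  define X where "X n N \<omega> = (\<Prod>i\<in>{n..<N}. fac (\<omega> i) (\<omega> (Suc i)))" for n N \<omega>
  \<comment> \<open>The one-step supermartingale inequality: from \<open>u\<close> the probability
    of avoiding \<open>w\<close> is at most \<open>1 - c\<close>, which the factor
    \<open>1 / (1 - c)\<close> compensates.\<close>
  have fac_sum: "(\<Sum>y\<in>verts G. fac (last h) y * ennreal (p h y)) \<le> 1"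
    if h: "set h \<subseteq> verts G" "h \<noteq> []" for h
  proof (cases "last h = u")
    case True
    have "(\<Sum>y\<in>verts G. fac (last h) y * ennreal (p h y)) =
        (\<Sum>y\<in>verts G - {w}. fac (last h) y * ennreal (p h y))"
      by (rule sum.mono_neutral_right) (auto simp: fac_def True finite_verts)
    also have "\<dots> = (\<Sum>y\<in>verts G - {w}. ennreal (1 / (1 - c) * p h y))"
      using c p_nonneg[OF h(1)]
      by (intro sum.cong refl, subst ennreal_mult) (auto simp: fac_def True)
    also have "\<dots> = ennreal (1 / (1 - c) * (\<Sum>y\<in>verts G - {w}. p h y))"
      using c p_nonneg[OF h(1)] by (subst sum_ennreal) (auto simp: sum_distrib_left)
    also have "(\<Sum>y\<in>verts G - {w}. p h y) = 1 - p h w"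
      using p_sum[OF h(1)] w by (simp add: sum_diff1 finite_verts)
    also have "ennreal (1 / (1 - c) * (1 - p h w)) \<le> ennreal 1"
      using c step[OF h True] by (intro ennreal_leI) (simp add: field_simps)
    finally show ?thesis by simp
  next
    case False
    then show ?thesis
      using p_sum[OF h(1)] p_nonneg[OF h(1)] by (simp add: fac_def sum_ennreal)
  qed
  \<comment> \<open>The last factor looks at the vertex with index \<open>N\<close>, so the history
    needed has length \<open>Suc N\<close>.\<close>
  have X_hist: "X n N \<omega> = (\<lambda>xs. \<Prod>i\<in>{n..<N}. fac (xs ! i) (xs ! Suc i)) (map \<omega> [0..<Suc N])"
    for n N \<omega>
    unfolding X_def by (intro prod.cong refl) (simp del: upt_Suc)
  have meas: "X n N \<in> borel_measurable M" for n N
  proof -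
    have "(\<lambda>\<omega>. (\<lambda>xs. \<Prod>i\<in>{n..<N}. fac (xs ! i) (xs ! Suc i)) (map \<omega> [0..<Suc N]))
        \<in> borel_measurable M"
      by (rule measurable_compose[OF measurable_hist]) simp
    then show ?thesis by (subst X_hist[abs_def])
  qed
  have EX: "(\<integral>\<^sup>+\<omega>. X n N \<omega> \<partial>M) \<le> 1" for n N
  proof (induction N)
    case 0
    then show ?case by (simp add: X_def emeasure_space_1)
  next
    case (Suc N)
    show ?case
    proof (cases "n \<le> N")
      case True
      let ?Y = "\<lambda>xs. \<Prod>i\<in>{n..<N}. fac (xs ! i) (xs ! Suc i)"
      let ?H = "\<lambda>\<omega>. map \<omega> [0..<Suc N]"
      have "X n (Suc N) \<omega> = X n N \<omega> * fac (\<omega> N) (\<omega> (Suc N))" for \<omega>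
        using True by (simp add: X_def prod.atLeastLessThan_Suc)
      also have "\<dots> \<omega> = ?Y (?H \<omega>) * fac (last (?H \<omega>)) (\<omega> (Suc N))" for \<omega>
        unfolding X_hist by simp
      finally have "(\<integral>\<^sup>+\<omega>. X n (Suc N) \<omega> \<partial>M) =
          (\<integral>\<^sup>+\<omega>. (\<lambda>h y. ?Y h * fac (last h) y) (?H \<omega>) (\<omega> (Suc N)) \<partial>M)"
        by (simp del: upt_Suc)
      also have "\<dots> = (\<integral>\<^sup>+\<omega>. (\<Sum>y\<in>verts G.
          (\<lambda>h y. ?Y h * fac (last h) y) (?H \<omega>) y * ennreal (p (?H \<omega>) y)) \<partial>M)"
        by (rule nn_integral_hist_Suc)
      also have "\<dots> \<le> (\<integral>\<^sup>+\<omega>. X n N \<omega> \<partial>M)"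
      proof (rule nn_integral_mono)
        fix \<omega> assume \<omega>: "\<omega> \<in> space M"
        have "(\<Sum>y\<in>verts G. ?Y (?H \<omega>) * fac (last (?H \<omega>)) y * ennreal (p (?H \<omega>) y)) =
            ?Y (?H \<omega>) * (\<Sum>y\<in>verts G. fac (last (?H \<omega>)) y * ennreal (p (?H \<omega>) y))"
          by (simp only: sum_distrib_left mult.assoc)
        also have "\<dots> \<le> ?Y (?H \<omega>) * 1"
          by (intro mult_left_mono fac_sum hist_verts \<omega>) auto
        finally show "(\<Sum>y\<in>verts G. ?Y (?H \<omega>) * fac (last (?H \<omega>)) y * ennreal (p (?H \<omega>) y))
            \<le> X n N \<omega>"
          unfolding X_hist by simp
      qed
      finally show ?thesis using Suc.IH by simp
    next
      case False
      then show ?thesis by (simp add: X_def emeasure_space_1)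
    qed
  qed
  \<comment> \<open>All starting times \<open>n\<close> are treated at once, because the time of the
    last visit to \<open>w\<close> depends on the play.\<close>
  have "AE \<omega> in M. \<forall>n. liminf (\<lambda>N. X n N \<omega>) \<noteq> \<infinity>"
  proof (rule AE_all_countable[THEN iffD2], rule allI)
    fix n
    have "(\<integral>\<^sup>+\<omega>. liminf (\<lambda>N. X n N \<omega>) \<partial>M) \<le> liminf (\<lambda>N. \<integral>\<^sup>+\<omega>. X n N \<omega> \<partial>M)"
      by (intro nn_integral_liminf meas)
    also have "\<dots> \<le> 1"
      using EX[of n] by (intro Liminf_le) auto
    finally have "(\<integral>\<^sup>+\<omega>. liminf (\<lambda>N. X n N \<omega>) \<partial>M) < \<infinity>"
      by (rule le_less_trans) simp
    then show "AE \<omega> in M. liminf (\<lambda>N. X n N \<omega>) \<noteq> \<infinity>"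
      by (intro nn_integral_noteq_infinite borel_measurable_liminf meas) auto
  qed
  then show ?thesis
  proof eventually_elim
    fix \<omega> assume fin: "\<forall>n. liminf (\<lambda>N. X n N \<omega>) \<noteq> \<infinity>"
    show "u \<in> inf_verts \<omega> \<longrightarrow> w \<in> inf_verts \<omega>"
    proof (intro impI, rule ccontr)
      assume u: "u \<in> inf_verts \<omega>" and "w \<notin> inf_verts \<omega>"
      then obtain n where n: "\<And>k. k \<ge> n \<Longrightarrow> \<omega> k \<noteq> w"
        by (auto simp: inf_verts_def INFM_nat_le not_le) (meson linorder_not_le)
      define r where "r = 1 / (1 - c)"
      have r: "r > 1" using c by (simp add: r_def field_simps)
      define K where "K N = card {i \<in> {n..<N}. \<omega> i = u}" for N
      \<comment> \<open>After time \<open>n\<close> no factor is 0, so only the powers of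
        \<open>r\<close> remain.\<close>
      have X_eq: "X n N \<omega> = ennreal (r ^ K N)" for N
      proof -
        have "X n N \<omega> = (\<Prod>i\<in>{n..<N}. if \<omega> i = u then ennreal r else 1)"
          unfolding X_def by (intro prod.cong refl) (auto simp: fac_def r_def n)
        also have "\<dots> = ennreal r ^ K N"
          by (simp add: K_def prod.If_cases Int_def)
        finally show ?thesis using r by (simp add: ennreal_power)
      qed
      have inf: "infinite ({n..} \<inter> {i. \<omega> i = u})"
      proof
        assume "finite ({n..} \<inter> {i. \<omega> i = u})"
        then have "finite ({..<n} \<union> ({n..} \<inter> {i. \<omega> i = u}))" by simp
        then have "finite {i. \<omega> i = u}"
          by (rule finite_subset[rotated]) auto
        then show False using u by (simp add: inf_verts_def INFM_iff_infinite)
      qed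
      have K_large: "\<forall>\<^sub>F N in sequentially. m \<le> K N" for m
      proof -
        obtain S where S: "finite S" "card S = m" "S \<subseteq> {n..} \<inter> {i. \<omega> i = u}"
          using infinite_arbitrarily_large[OF inf] by blast
        have "m \<le> K N" if "Suc (Max S) \<le> N" for N
        proof -
          have "i < N" if "i \<in> S" for i
            using Max_ge[OF S(1) that] \<open>Suc (Max S) \<le> N\<close> by simp
          then have "S \<subseteq> {i \<in> {n..<N}. \<omega> i = u}"
            using S(3) by auto
          then show ?thesis unfolding K_def S(2)[symmetric] by (rule card_mono[rotated]) simp
        qed
        then show ?thesis by (auto simp: eventually_sequentially)
      qed
      have "ennreal (r ^ m) \<le> liminf (\<lambda>N. X n N \<omega>)" for m
      proof (rule Liminf_bounded)
        show "\<forall>\<^sub>F N in sequentially. ennreal (r ^ m) \<le> X n N \<omega>"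
          using K_large[of m]
          by eventually_elim (use r in \<open>auto simp: X_eq intro!: ennreal_leI power_increasing\<close>)
      qed
      moreover obtain L where L: "liminf (\<lambda>N. X n N \<omega>) = ennreal L" "L \<ge> 0"
        using fin[rule_format, of n] by (cases "liminf (\<lambda>N. X n N \<omega>)") auto
      ultimately have "r ^ m \<le> L" for m
        using r by (simp add: ennreal_le_iff)
      then show False using real_arch_pow[OF r, of L] by (meson not_le)
    qed
  qed
qed

section \<open>Measurable events and almost sure limit behaviour\<close>

lemma AE_paths: "AE \<omega> in M. \<omega> \<in> paths G \<and> \<omega> 0 = v"
  by (rule AE_play_measure_paths[OF strategy1 strategy2 init])

lemma paths_sets [measurable]: "{\<omega> \<in> space M. \<omega> \<in> paths G} \<in> sets M"
proof -
  have "Measurable.pred M (\<lambda>\<omega>. 0 < delta G (\<omega> k) (\<omega> (Suc k)))" for k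
  proof -
    have "(\<lambda>\<omega>. (\<lambda>xs. 0 < delta G (xs ! k) (xs ! Suc k)) (map \<omega> [0..<Suc (Suc k)]))
        \<in> measurable M (count_space UNIV)"
      by (rule measurable_compose[OF measurable_hist]) simp
    then show ?thesis by (simp del: upt_Suc)
  qed
  then have "{\<omega> \<in> space M. \<forall>k. 0 < delta G (\<omega> k) (\<omega> (Suc k))} \<in> sets M"
    by measurable
  moreover have "{\<omega> \<in> space M. \<omega> \<in> paths G} = {\<omega> \<in> space M. \<forall>k. 0 < delta G (\<omega> k) (\<omega> (Suc k))}"
    by (auto simp: space_M paths_def)
  ultimately show ?thesis by simp
qed

lemma paths_subset_space: "paths G \<subseteq> space M"
  by (auto simp: paths_def space_M)

text \<open>Measurability allows passing from an almost sure statement to probability 1;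
  \<open>measure\<close> is 0 on nonmeasurable sets.\<close>

lemma eventually_visits_sets: "eventually_visits G C \<in> sets M"
proof -
  have "Measurable.pred M (\<lambda>\<omega>. \<omega> k \<in> C)" for k
    by (rule measurable_compose[OF measurable_vertex]) simp
  then have "{\<omega> \<in> space M. \<omega> \<in> paths G \<and> (\<exists>k. \<omega> k \<in> C)} \<in> sets M"
    by measurable
  moreover have "eventually_visits G C = {\<omega> \<in> space M. \<omega> \<in> paths G \<and> (\<exists>k. \<omega> k \<in> C)}"
    using paths_subset_space by (auto simp: eventually_visits_def)
  ultimately show ?thesis by simp
qed

lemma fair_plays2_sets: "fair_plays2 G \<in> sets M"
proof -
  have fin: "finite (verts2 G)"
    using finite_verts verts_Un by simp
  have "Measurable.pred M (\<lambda>\<omega>. \<forall>a\<in>verts2 G. a \<in> inf_verts \<omega> \<longrightarrow> (\<forall>b\<in>post G a. b \<in> inf_verts \<omega>))"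
    using fin finite_post by (intro pred_intros_finite pred_intros_logic measurable_inf_verts)
  then have "{\<omega> \<in> space M. \<omega> \<in> paths G \<and>
      (\<forall>a\<in>verts2 G. a \<in> inf_verts \<omega> \<longrightarrow> (\<forall>b\<in>post G a. b \<in> inf_verts \<omega>))} \<in> sets M"
    by measurable
  moreover have "fair_plays2 G = {\<omega> \<in> space M. \<omega> \<in> paths G \<and>
      (\<forall>a\<in>verts2 G. a \<in> inf_verts \<omega> \<longrightarrow> (\<forall>b\<in>post G a. b \<in> inf_verts \<omega>))}"
    using paths_subset_space by (auto simp: fair_plays2_def)
  ultimately show ?thesis by simp
qed

text \<open>The bound \<open>e\<close> may depend on \<open>w\<close> but must be uniform in the
  history; the finitely many exceptional null sets are then combined.\<close>

lemma AE_inf_verts_post: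
  assumes "\<And>w. w \<in> post G u \<Longrightarrow>
    \<exists>e>0. \<forall>h. set h \<subseteq> verts G \<longrightarrow> h \<noteq> [] \<longrightarrow> last h = u \<longrightarrow> e \<le> step_prob G \<pi>1 \<pi>2 h w"
  shows "AE \<omega> in M. u \<in> inf_verts \<omega> \<longrightarrow> post G u \<subseteq> inf_verts \<omega>"
proof -
  have "AE \<omega> in M. u \<in> inf_verts \<omega> \<longrightarrow> w \<in> inf_verts \<omega>" if "w \<in> post G u" for w
  proof -
    from assms[OF that] obtain e where "e > 0" and
      "\<And>h. set h \<subseteq> verts G \<Longrightarrow> h \<noteq> [] \<Longrightarrow> last h = u \<Longrightarrow> e \<le> step_prob G \<pi>1 \<pi>2 h w"
      by blast
    then show ?thesis
      using that post_subset_verts[of u]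
      by (intro AE_inf_verts_step[of e]) (auto simp: init_step_prob_def)
  qed
  then have "AE \<omega> in M. \<forall>w\<in>post G u. u \<in> inf_verts \<omega> \<longrightarrow> w \<in> inf_verts \<omega>"
    by (intro AE_finite_allI finite_post)
  then show ?thesis by eventually_elim auto
qed

text \<open>At a probabilistic vertex the step probability is \<open>delta G u w\<close> for every
  history, which is itself the required bound.\<close>

lemma AE_inf_verts_post_P:
  "AE \<omega> in M. \<forall>u\<in>vertsP G. u \<in> inf_verts \<omega> \<longrightarrow> post G u \<subseteq> inf_verts \<omega>"
proof (rule AE_finite_allI)
  show "finite (vertsP G)" using finite_verts verts_Un by simp
  fix u assume "u \<in> vertsP G"
  then have "u \<notin> verts1 G" "u \<notin> verts2 G" using verts_disjoint by auto
  then show "AE \<omega> in M. u \<in> inf_verts \<omega> \<longrightarrow> post G u \<subseteq> inf_verts \<omega>"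
    by (intro AE_inf_verts_post) (auto simp: step_prob_def post_def)
qed

text \<open>The play never enters the trap's complement \<open>?E\<close>, hence stays in
  \<open>?W\<close>. Its nonempty limit set therefore meets \<open>?W\<close>, and by almost sure
  fairness at Player 2 and probabilistic vertices it meets the terminal vertices.\<close>

lemma prob_eventually_terminal_if:
  assumes fair: "fair_strategy2 G \<pi>2"
    and v: "v \<notin> pre_star (exists_pre G) (verts G - pre_star (forall_pre G) (terminal_verts G))"
      (is "v \<notin> ?E")
  shows "prob (eventually_visits G (terminal_verts G)) = 1"
proof -
  let ?W = "pre_star (forall_pre G) (terminal_verts G)"
  have "prob (fair_plays2 G) = 1"
    using fair strategy1 init by (simp add: fair_strategy2_def play_prob_def)
  then have "AE \<omega> in M. \<omega> \<in> fair_plays2 G" by (rule AE_prob_1)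
  with AE_paths AE_inf_verts_post_P
  have "AE \<omega> in M. \<omega> \<in> eventually_visits G (terminal_verts G)"
  proof eventually_elim
    fix \<omega> assume path: "\<omega> \<in> paths G \<and> \<omega> 0 = v"
      and P: "\<forall>u\<in>vertsP G. u \<in> inf_verts \<omega> \<longrightarrow> post G u \<subseteq> inf_verts \<omega>"
      and fp: "\<omega> \<in> fair_plays2 G"
    have notE: "\<omega> k \<notin> ?E" for k
    proof (induction k)
      case (Suc k)
      have "\<omega> k \<in> verts G" using path by (simp add: paths_def)
      from post_pre_star_exists_pre[OF _ this Suc.IH] path_post[of \<omega> k] path
      show ?case by auto
    qed (use path v in simp)
    then have "\<omega> k \<in> ?W" for k
      using path subset_pre_star[of "verts G - ?W" "exists_pre G"] by (auto simp: paths_def)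
    then have "inf_verts \<omega> \<subseteq> ?W"
      by (auto simp: inf_verts_def dest!: INFM_EX)
    then have "inf_verts \<omega> \<inter> ?W \<noteq> {}"
      using inf_verts_nonempty path by blast
    moreover have "post G u \<subseteq> inf_verts \<omega>" if "u \<in> (verts2 G \<union> vertsP G) \<inter> inf_verts \<omega>" for u
      using that P fp by (auto simp: fair_plays2_def)
    ultimately have "inf_verts \<omega> \<inter> terminal_verts G \<noteq> {}"
      using inf_verts_disjoint_pre_star[of \<omega> "terminal_verts G"] path terminal_verts_subset by blast
    then show "\<omega> \<in> eventually_visits G (terminal_verts G)"
      using path by (auto simp: eventually_visits_def inf_verts_def dest!: INFM_EX)
  qed
  then show ?thesis
    using eventually_visits_sets by (simp add: prob_eq_1)
qed

end

section \<open>Witness strategies and the characterisation\<close>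

context stochastic_game
begin

lemma strategy2_uniform: "strategy2 G (\<lambda>h. pmf_of_set (post G (last h)))"
  using post_nonempty verts_Un by (intro strategy_pmf_of_set) auto

text \<open>Each successor of \<open>u\<close> is chosen with probability
  \<open>1 / card (post G u)\<close> whatever the history and whatever Player 1 does, so the
  recurrence lemma applies.\<close>

lemma fair_strategy2_uniform: "fair_strategy2 G (\<lambda>h. pmf_of_set (post G (last h)))"
    (is "fair_strategy2 G ?\<pi>2")
  unfolding fair_strategy2_def
proof (intro conjI allI impI strategy2_uniform)
  fix \<pi>1 v assume "strategy1 G \<pi>1" "v \<in> verts G"
  then interpret play G \<pi>1 ?\<pi>2 v
    by unfold_locales (auto intro: strategy2_uniform)
  have "AE \<omega> in M. \<forall>u\<in>verts2 G. u \<in> inf_verts \<omega> \<longrightarrow> post G u \<subseteq> inf_verts \<omega>"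
  proof (rule AE_finite_allI)
    show "finite (verts2 G)" using finite_verts verts_Un by simp
    fix u assume u: "u \<in> verts2 G"
    then have "post G u \<noteq> {}" using post_nonempty verts_Un by auto
    then have "card (post G u) > 0" using finite_post by (simp add: card_gt_0_iff)
    moreover have "u \<notin> verts1 G" using verts_disjoint u by auto
    ultimately show "AE \<omega> in M. u \<in> inf_verts \<omega> \<longrightarrow> post G u \<subseteq> inf_verts \<omega>"
      using u \<open>post G u \<noteq> {}\<close> finite_post
      by (intro AE_inf_verts_post exI[of _ "1 / card (post G u)"])
        (auto simp: step_prob_def)
  qed
  with AE_paths have "AE \<omega> in M. \<omega> \<in> fair_plays2 G"
    by eventually_elim (auto simp: fair_plays2_def)
  then show "play_prob G \<pi>1 ?\<pi>2 v (fair_plays2 G) = 1"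
    using fair_plays2_sets by (simp add: play_prob_def prob_eq_1)
qed

text \<open>The witness is a cylinder of positive probability on which almost no play visits a
  terminal vertex.\<close>

lemma prob_eventually_terminal_less_1:
  assumes "v \<in> pre_star (exists_pre G) (verts G - pre_star (forall_pre G) (terminal_verts G))"
  shows "\<exists>\<pi>1 \<pi>2. strategy1 G \<pi>1 \<and> fair_strategy2 G \<pi>2 \<and>
    play_prob G \<pi>1 \<pi>2 v (eventually_visits G (terminal_verts G)) \<noteq> 1"
proof -
  let ?T = "terminal_verts G"
  define W where "W = pre_star (forall_pre G) ?T"
  define B where "B = verts G - W"
  define A where "A u = (if u \<in> B then post G u \<inter> B else post G u)" for u
  let ?\<pi>1 = "\<lambda>h. pmf_of_set (A (last h))"
  let ?\<pi>2 = "\<lambda>h. pmf_of_set (post G (last h))"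
  have T: "?T \<inter> B = {}" using subset_pre_star[of ?T] by (auto simp: B_def W_def)
  note B_cases = not_in_pre_star_forall_pre[OF terminal_verts_subset, folded W_def]
  have B_post: "post G u \<inter> B \<noteq> {}" if "u \<in> B" for u
    using that B_cases[of u] post_nonempty[of u] post_subset_verts[of u]
    by (cases "u \<in> verts1 G") (auto simp: B_def)
  have s1: "strategy1 G ?\<pi>1"
    using B_post post_nonempty verts_Un by (intro strategy_pmf_of_set) (auto simp: A_def)
  have "v \<in> pre_star (exists_pre G) B" "B \<subseteq> verts G"
    using assms by (auto simp: B_def W_def)
  from pre_star_exists_pre_path[OF this(2,1)] obtain xs where
    xs: "xs \<noteq> []" "hd xs = v" "last xs \<in> B" "set xs \<subseteq> verts G"
    and path: "\<And>i. Suc i < length xs \<Longrightarrow> xs ! i \<notin> B \<and> xs ! Suc i \<in> post G (xs ! i)"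
    by blast
  from xs have "v \<in> verts G" by auto
  then interpret play G ?\<pi>1 ?\<pi>2 v
    by unfold_locales (auto intro: strategy2_uniform s1)
  \<comment> \<open>All vertices of \<open>xs\<close> before the last lie outside \<open>B\<close>,
    where \<open>A\<close> is the full successor set, so every step has positive
    probability.\<close>
  have "p (take i xs) (xs ! i) > 0" if i: "i < length xs" for i
  proof (cases i)
    case 0
    then show ?thesis using xs by (simp add: init_step_prob_def hd_conv_nth)
  next
    case (Suc j)
    then have j: "xs ! j \<notin> B" "xs ! Suc j \<in> post G (xs ! j)" using path i by auto
    moreover from j have "post G (xs ! j) \<noteq> {}" "delta G (xs ! j) (xs ! Suc j) > 0"
      by (auto simp: post_def)
    moreover have "last (take (Suc j) xs) = xs ! j"
      using i Suc by (simp add: take_Suc_conv_app_nth)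
    moreover have "take (Suc j) xs \<noteq> []" using xs by simp
    ultimately show ?thesis
      using finite_post[of "xs ! j"] Suc
      by (simp add: init_step_prob_def step_prob_def A_def card_gt_0_iff)
  qed
  then have "0 < (\<Prod>i<length xs. p (take i xs) (xs ! i))" by (intro prod_pos) auto
  then have pos: "emeasure M (cyl xs) > 0"
    by (simp add: emeasure_cyl[OF xs(4)])
  have "AE \<omega> in M. \<omega> \<in> cyl xs \<longrightarrow> \<omega> \<notin> eventually_visits G ?T"
    using AE_paths AE_step_nonzero
  proof eventually_elim
    fix \<omega> assume \<omega>: "\<omega> \<in> paths G \<and> \<omega> 0 = v" and nz: "\<forall>n. p (map \<omega> [0..<n]) (\<omega> n) \<noteq> 0"
    show "\<omega> \<in> cyl xs \<longrightarrow> \<omega> \<notin> eventually_visits G ?T"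
    proof (intro impI notI)
      assume "\<omega> \<in> cyl xs" "\<omega> \<in> eventually_visits G ?T"
      then obtain k where k: "\<omega> k \<in> ?T" by (auto simp: eventually_visits_def)
      \<comment> \<open>The index of the last vertex of \<open>xs\<close>, a time at which the play
        is in \<open>B\<close>.\<close>
      define l where "l = length xs - 1"
      have "\<omega> l \<in> B"
        using \<open>\<omega> \<in> cyl xs\<close> xs by (simp add: l_def cyl_def last_conv_nth)
      have step: "\<omega> (Suc n) \<in> B" if n: "\<omega> n \<in> B" for n
      proof (cases "\<omega> n \<in> verts1 G")
        case True
        \<comment> \<open>The support of Player 1's choice matters here; at the other vertices of
          \<open>B\<close> being a path suffices.\<close>
        have "pmf (pmf_of_set (post G (\<omega> n) \<inter> B)) (\<omega> (Suc n)) \<noteq> 0"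
          using nz[rule_format, of "Suc n"] n True
          by (simp add: init_step_prob_def step_prob_def A_def)
        then show ?thesis
          using B_post[OF n] finite_post[of "\<omega> n"] by (simp add: indicator_def split: if_splits)
      next
        case False
        then have "post G (\<omega> n) \<inter> W = {}" using B_cases(2)[of "\<omega> n"] n by (simp add: B_def)
        then show ?thesis
          using path_post[of \<omega> n] \<omega> post_subset_verts[of "\<omega> n"] by (auto simp: B_def)
      qed
      have "\<omega> n \<in> B" if "l \<le> n" for n
        using that by (induction n rule: dec_induct) (auto intro: \<open>\<omega> l \<in> B\<close> step)
      \<comment> \<open>A terminal visit at time \<open>k\<close> persists, so it is compared with
        \<open>B\<close> at a time not before \<open>l\<close>; this also excludes visits with
        \<open>k < l\<close>.\<close>
      moreover have "\<omega> (max k l) \<in> ?T"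
        using path_terminal[of \<omega> k "max k l"] \<omega> k by simp
      ultimately show False using T by (meson disjoint_iff max.cobounded2)
    qed
  qed
  moreover have "\<not> (AE \<omega> in M. \<omega> \<notin> cyl xs)"
    using pos by (simp add: AE_iff_measurable[OF cyl_sets] cyl_def space_M)
  ultimately have "\<not> (AE \<omega> in M. \<omega> \<in> eventually_visits G ?T)"
    by (metis (mono_tags, lifting) AE_mp AE_I2)
  then have "prob (eventually_visits G ?T) \<noteq> 1"
    using AE_prob_1 by blast
  then show ?thesis
    using s1 fair_strategy2_uniform unfolding play_prob_def by blast
qed

lemma prob_eventually_terminal_iff:
  assumes "v \<in> verts G"
  shows "(\<forall>\<pi>1 \<pi>2. strategy1 G \<pi>1 \<longrightarrow> fair_strategy2 G \<pi>2 \<longrightarrow>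
      play_prob G \<pi>1 \<pi>2 v (eventually_visits G (terminal_verts G)) = 1) \<longleftrightarrow>
    v \<notin> pre_star (exists_pre G) (verts G - pre_star (forall_pre G) (terminal_verts G))"
    (is "?L \<longleftrightarrow> v \<notin> ?E")
proof
  assume ?L
  then show "v \<notin> ?E" using prob_eventually_terminal_less_1 by blast
next
  assume v: "v \<notin> ?E"
  show ?L
  proof (intro allI impI)
    fix \<pi>1 \<pi>2 assume s: "strategy1 G \<pi>1" "fair_strategy2 G \<pi>2"
    then interpret play G \<pi>1 \<pi>2 v
      using assms by unfold_locales (auto simp: fair_strategy2_def)
    show "play_prob G \<pi>1 \<pi>2 v (eventually_visits G (terminal_verts G)) = 1"
      unfolding play_prob_def by (rule prob_eventually_terminal_if[OF s(2) v])
  qed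
qed

end

theorem theorem2:
  fixes G :: "'v game"
  assumes "stochastic_game G"
  shows "(\<forall>v \<in> verts G.
            (\<forall>\<pi>1 \<pi>2. strategy1 G \<pi>1 \<longrightarrow> fair_strategy2 G \<pi>2 \<longrightarrow>
               play_prob G \<pi>1 \<pi>2 v (eventually_visits G (terminal_verts G)) = 1)
            \<longleftrightarrow> v \<in> verts G - pre_star (exists_pre G)
                      (verts G - pre_star (forall_pre G) (terminal_verts G)))
       \<and> (stopping_under_fairness G
            \<longleftrightarrow> pre_star (exists_pre G)
                  (verts G - pre_star (forall_pre G) (terminal_verts G)) = {})"
proof -
  interpret stochastic_game G by (rule assms)
  let ?E = "pre_star (exists_pre G) (verts G - pre_star (forall_pre G) (terminal_verts G))"
  have "?E \<subseteq> verts G" by (rule pre_star_exists_pre_subset) auto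
  then have "(\<forall>v\<in>verts G. v \<notin> ?E) \<longleftrightarrow> ?E = {}" by blast
  moreover have "stopping_under_fairness G \<longleftrightarrow> (\<forall>v\<in>verts G. v \<notin> ?E)"
    using prob_eventually_terminal_iff unfolding stopping_under_fairness_def by blast
  ultimately show ?thesis
    using prob_eventually_terminal_iff by simp
qed

end
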